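(* Let $n\ge 1$, let $A,B\in M_n(\mathbb{C})$ and let $1\le p\le\infty$ (with $1/p=0$ if $p=\infty$). Then $$\|A+B\|_p\le 2^{1-\frac1p}\,\omega_p\left(\begin{bmatrix} 0 & A \\ B^* & 0 \end{bmatrix}\right)\le\|A\|_p+\|B\|_p.$$
   Context: $M_m(\mathbb{C})$ is the space of $m\times m$ complex matrices, $T^*$ the conjugate transpose, $\operatorname{Re}(T)=\frac12(T+T^* )$. For $1\le p<\infty$, $\|T\|_p=(\operatorname{tr}((T^*T)^{p/2}))^{1/p}$ is the Schatten $p$-norm; $\|T\|_\infty$ is the operator norm. The Schatten $p$-generalized numerical radius of a square complex matrix $T$ is $\omega_p(T)=\sup_{\theta\in\mathbb{R}}\|\operatorname{Re}(e^{i\theta}T)\|_p$. *)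

theory Defs
  imports "HOL-Analysis.Analysis"
begin

(* Square complex matrices are of type complex^'n^'n, where 'n is a nonempty finite index type;
   the size is CARD('n). *)

definition adjoint_matrix :: "complex^'n^'m \<Rightarrow> complex^'m^'n" where
  "adjoint_matrix T = (\<chi> i j. cnj (T $ j $ i))"

definition unitary_matrix :: "complex^'n^'n \<Rightarrow> bool" where
  "unitary_matrix U \<longleftrightarrow>
     adjoint_matrix U ** U = mat 1 \<and> U ** adjoint_matrix U = mat 1"

definition real_diag :: "('n \<Rightarrow> real) \<Rightarrow> complex^'n^'n" where
  "real_diag d = (\<chi> i j. if i = j then complex_of_real (d i) else 0)"

(* Continuous functional calculus: the power P^r of a positive semidefinite Hermitian matrix P
   is U diag(d_i^r) U* for any unitary diagonalisation P = U diag(d_i) U*; it does not depend on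
   the diagonalisation chosen. Only exponents r > 0 are used, for which 0 powr r = 0 is the
   usual value. For P not positive semidefinite the value is unspecified. *)
definition psd_power :: "complex^'n^'n \<Rightarrow> real \<Rightarrow> complex^'n^'n" where
  "psd_power P r = (THE S. \<exists>U d. unitary_matrix U \<and> (\<forall>i. 0 \<le> d i) \<and>
      P = U ** real_diag d ** adjoint_matrix U \<and>
      S = U ** real_diag (\<lambda>i. d i powr r) ** adjoint_matrix U)"

(* Intended for 1 \<le> p \<le> \<infinity>. The trace below is a nonnegative real number, so taking its real
   part only changes the type. The norm on complex^'n is the Euclidean one, so for p = \<infinity> this is
   the usual operator norm. *)
definition schatten_norm :: "ereal \<Rightarrow> complex^'n^'n \<Rightarrow> real" where
  "schatten_norm p T =
     (if p = \<infinity> then onorm (\<lambda>x. T *v x)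
      else Re (trace (psd_power (adjoint_matrix T ** T) (real_of_ereal p / 2)))
             powr (1 / real_of_ereal p))"

definition re_part :: "complex^'n^'n \<Rightarrow> complex^'n^'n" where
  "re_part T = (1 / 2) *\<^sub>R (T + adjoint_matrix T)"

(* cis \<theta> is exp (\<i> \<theta>), and mat (cis \<theta>) is the corresponding scalar matrix. The supremum is taken
   in the reals; the set is bounded, being the range of a continuous periodic function. *)
definition schatten_num_radius :: "ereal \<Rightarrow> complex^'n^'n \<Rightarrow> real" where
  "schatten_num_radius p T = (SUP \<theta>::real. schatten_norm p (re_part (mat (cis \<theta>) ** T)))"

(* The matrix with block rows (A B) and (C D). *)
definition block_matrix ::
  "'a^'n^'m \<Rightarrow> 'a^'l^'m \<Rightarrow> 'a^'n^'k \<Rightarrow> 'a^'l^'k \<Rightarrow> 'a^('n + 'l)^('m + 'k)" where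
  "block_matrix A B C D = (\<chi> i j.
     case i of
       Inl a \<Rightarrow> (case j of Inl b \<Rightarrow> A $ a $ b | Inr b \<Rightarrow> B $ a $ b)
     | Inr a \<Rightarrow> (case j of Inl b \<Rightarrow> C $ a $ b | Inr b \<Rightarrow> D $ a $ b))"

end

theory Submission
  imports Defs
begin

text \<open>The matrix \<open>Re (e\<^sup>i\<^sup>\<theta> T)\<close> for \<open>T = (0 A; B\<^sup>* 0)\<close> is half the Hermitian dilation
  \<open>(0 C; C\<^sup>* 0)\<close> of \<open>C = e\<^sup>i\<^sup>\<theta> A + e\<^sup>-\<^sup>i\<^sup>\<theta> B\<close>, whose singular values are those of \<open>C\<close>, each taken twice.
  Hence the middle term of the claim is the supremum over \<open>\<theta>\<close> of the Schatten norms of \<open>C\<close>. The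
  choice \<open>\<theta> = 0\<close> gives the first inequality; the triangle inequality and unitary invariance give
  the second. For finite \<open>p\<close>, the triangle inequality follows from Minkowski's inequality for
  sums, since the \<open>p\<close>-norm of the diagonal of \<open>P T Q\<close> with \<open>P\<close> and \<open>Q\<close> unitary is at most the
  Schatten norm of \<open>T\<close>, with equality if \<open>P T Q\<close> is the diagonal matrix of a singular value
  decomposition.\<close>

section \<open>Convexity of powers and Minkowski's inequality for finite sums\<close>

lemma powr_convex_nonneg:
  assumes "1 \<le> (p::real)"
  shows "convex_on {0..} (\<lambda>x. x powr p)"
proof (rule convex_onI)
  fix t x y :: real
  assume t: "0 < t" "t < 1" and xy: "x \<in> {0..}" "y \<in> {0..}"
  \<comment> \<open>When one of the two points is 0, convexity reduces to this estimate, which holds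
    because \<open>c powr p\<close> \<le> \<open>c\<close> for \<open>c\<close> in (0,1).\<close>
  have scale: "(c * z) powr p \<le> c * z powr p" if "0 < c" "c < 1" "0 \<le> z" for c z
    using that assms powr_mono'[of 1 p c] by (simp add: powr_mult mult_right_mono)
  consider "x = 0" | "y = 0" | "0 < x" "0 < y"
    using xy by fastforce
  then show "((1 - t) *\<^sub>R x + t *\<^sub>R y) powr p \<le> (1 - t) * x powr p + t * y powr p"
  proof cases
    case 1
    then show ?thesis using scale[of t y] t xy by simp
  next
    case 2
    then show ?thesis using scale[of "1 - t" x] t xy by simp
  next
    case 3
    then show ?thesis using convex_onD[OF powr_convex[OF assms], of t x y] t by simp
  qed
qed simp

text \<open>After division by \<alpha> + \<beta>, each \<open>a i + b i\<close> is a convex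
  combination of \<open>a i / \<alpha>\<close> and \<open>b i / \<beta>\<close>, so convexity of the
  power can be summed over \<open>i\<close>. Upper bounds \<alpha> and \<beta> replace the exact
  norms, so that the Schatten norms can be inserted directly.\<close>

lemma Minkowski_powr_sum:
  fixes a b :: "'a \<Rightarrow> real"
  assumes p: "1 \<le> p" and fin: "finite S"
    and a: "\<And>i. i \<in> S \<Longrightarrow> 0 \<le> a i" and b: "\<And>i. i \<in> S \<Longrightarrow> 0 \<le> b i"
    and \<alpha>: "(\<Sum>i\<in>S. a i powr p) \<le> \<alpha> powr p" "0 \<le> \<alpha>"
    and \<beta>: "(\<Sum>i\<in>S. b i powr p) \<le> \<beta> powr p" "0 \<le> \<beta>"
  shows "(\<Sum>i\<in>S. (a i + b i) powr p) \<le> (\<alpha> + \<beta>) powr p"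
proof -
  \<comment> \<open>Division by \<alpha> or \<beta> fails if one of them is 0; in that case the
    corresponding family vanishes, as \<open>0 powr p\<close> is 0.\<close>
  have zero: "\<forall>i\<in>S. f i = 0" if "(\<Sum>i\<in>S. f i powr p) \<le> 0 powr p" for f :: "'a \<Rightarrow> real"
  proof -
    have "(\<Sum>i\<in>S. f i powr p) = 0"
      using that by (simp add: order_antisym sum_nonneg)
    then show ?thesis
      using fin by (simp add: sum_nonneg_eq_0_iff)
  qed
  consider "\<alpha> = 0" | "\<beta> = 0" | "0 < \<alpha>" "0 < \<beta>"
    using \<alpha> \<beta> by fastforce
  then show ?thesis
  proof cases
    case 1
    then show ?thesis using zero[of a] \<alpha> \<beta> by simp
  next
    case 2
    then show ?thesis using zero[of b] \<alpha> \<beta> by simp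
  next
    case 3
    define t where "t = \<beta> / (\<alpha> + \<beta>)"
    have t: "0 \<le> t" "t \<le> 1" "1 - t = \<alpha> / (\<alpha> + \<beta>)"
      using 3 by (auto simp: t_def field_simps)
    have "(a i + b i) powr p
        \<le> (\<alpha> + \<beta>) powr p * ((1 - t) * (a i powr p / \<alpha> powr p) + t * (b i powr p / \<beta> powr p))"
      if "i \<in> S" for i
    proof -
      have "(a i + b i) powr p = ((\<alpha> + \<beta>) * ((1 - t) * (a i / \<alpha>) + t * (b i / \<beta>))) powr p"
        using 3 unfolding t(3) by (simp add: t_def distrib_left add_eq_0_iff)
      also have "\<dots> = (\<alpha> + \<beta>) powr p * ((1 - t) * (a i / \<alpha>) + t * (b i / \<beta>)) powr p"
        using 3 t a b that by (simp add: powr_mult)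
      also have "((1 - t) * (a i / \<alpha>) + t * (b i / \<beta>)) powr p
          \<le> (1 - t) * (a i / \<alpha>) powr p + t * (b i / \<beta>) powr p"
        using convex_onD[OF powr_convex_nonneg[OF p], of t "a i / \<alpha>" "b i / \<beta>"] 3 t a b that
        by simp
      finally show ?thesis
        using 3 a b that by (simp add: powr_divide mult_left_mono)
    qed
    then have "(\<Sum>i\<in>S. (a i + b i) powr p)
        \<le> (\<Sum>i\<in>S. (\<alpha> + \<beta>) powr p
              * ((1 - t) * (a i powr p / \<alpha> powr p) + t * (b i powr p / \<beta> powr p)))"
      by (rule sum_mono)
    also have "\<dots> = (\<alpha> + \<beta>) powr p * ((1 - t) * ((\<Sum>i\<in>S. a i powr p) / \<alpha> powr p)
        + t * ((\<Sum>i\<in>S. b i powr p) / \<beta> powr p))"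
      by (simp add: sum_distrib_left sum.distrib sum_divide_distrib distrib_left)
    also have "\<dots> \<le> (\<alpha> + \<beta>) powr p * ((1 - t) * 1 + t * 1)"
      using 3 t \<alpha> \<beta> by (intro mult_left_mono add_mono) (auto simp: divide_le_eq_1)
    finally show ?thesis by simp
  qed
qed

subsection \<open>Singular value decomposition\<close>

text \<open>The Hermitian form, conjugate-linear in the first argument. Its real part is the real
  inner product of the vector type, which gives access to the Euclidean norm and to
  Cauchy-Schwarz.\<close>

definition cinner :: "complex^'n \<Rightarrow> complex^'n \<Rightarrow> complex" where
  "cinner u v = (\<Sum>i\<in>UNIV. cnj (u $ i) * v $ i)"

lemma Re_cinner: "Re (cinner u v) = u \<bullet> v"
  by (simp add: cinner_def inner_vec_def inner_complex_def)

lemma cnj_cinner: "cnj (cinner u v) = cinner v u"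
  by (simp add: cinner_def mult.commute)

lemma cinner_self: "cinner u u = complex_of_real ((norm u)\<^sup>2)"
proof -
  have "Im (cinner u u) = 0"
    using cnj_cinner[of u u] by (metis Reals_cnj_iff complex_is_Real_iff)
  then show ?thesis
    by (simp add: complex_eq_iff Re_cinner power2_norm_eq_inner)
qed

lemma cinner_scaleR_left: "cinner (c *\<^sub>R u) v = c *\<^sub>R cinner u v"
  by (simp add: cinner_def scaleR_sum_right)

lemma cinner_scaleR_right: "cinner u (c *\<^sub>R v) = c *\<^sub>R cinner u v"
  by (simp add: cinner_def scaleR_sum_right)

lemma cinner_adjoint_left: "cinner (adjoint_matrix T *v u) v = cinner u (T *v v)"
proof -
  have "cinner (adjoint_matrix T *v u) v = (\<Sum>i\<in>UNIV. \<Sum>j\<in>UNIV. T $ j $ i * cnj (u $ j) * v $ i)"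
    by (simp add: cinner_def matrix_vector_mult_def adjoint_matrix_def sum_distrib_right)
  also have "\<dots> = (\<Sum>j\<in>UNIV. \<Sum>i\<in>UNIV. T $ j $ i * cnj (u $ j) * v $ i)"
    by (rule sum.swap)
  also have "\<dots> = cinner u (T *v v)"
    by (simp add: cinner_def matrix_vector_mult_def sum_distrib_left mult_ac)
  finally show ?thesis .
qed

lemma adjoint_adjoint [simp]: "adjoint_matrix (adjoint_matrix T) = T"
  by (simp add: adjoint_matrix_def vec_eq_iff)

lemma adjoint_zero [simp]: "adjoint_matrix 0 = 0"
  by (simp add: adjoint_matrix_def vec_eq_iff)

lemma adjoint_mult: "adjoint_matrix (S ** T) = adjoint_matrix T ** adjoint_matrix S"
  by (simp add: adjoint_matrix_def matrix_matrix_mult_def vec_eq_iff mult.commute)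

lemma adjoint_real_diag [simp]: "adjoint_matrix (real_diag d) = real_diag d"
  by (auto simp: adjoint_matrix_def real_diag_def vec_eq_iff)

lemma cinner_adjoint_right: "cinner u (adjoint_matrix T *v v) = cinner (T *v u) v"
  using cinner_adjoint_left[of "adjoint_matrix T"] by simp

text \<open>The conjugated vectors form the rows of a square matrix whose row \<open>a\<close> is
  zero. This matrix is singular, and a normalised kernel vector is orthogonal to all of
  them.\<close>

lemma exists_unit_orthogonal:
  fixes u :: "'n::finite \<Rightarrow> complex^'n"
  assumes "a \<notin> I"
  shows "\<exists>x. norm x = 1 \<and> (\<forall>i\<in>I. cinner (u i) x = 0)"
proof -
  define M :: "complex^'n^'n" where
    "M = (\<chi> i. if i \<in> I then \<chi> j. cnj (u i $ j) else 0)"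
  have "row a M = 0"
    using assms by (simp add: row_def M_def vec_eq_iff)
  then have "\<not> invertible M"
    by (simp add: invertible_det_nz det_zero_row)
  then obtain x where x: "M *v x = 0" "x \<noteq> 0"
    using matrix_left_invertible_ker[of M] by (auto simp: invertible_left_inverse)
  have "cinner (u i) x = 0" if "i \<in> I" for i
  proof -
    have "(M *v x) $ i = cinner (u i) x"
      using that by (simp add: M_def matrix_vector_mult_def cinner_def)
    then show ?thesis using x by simp
  qed
  then have "norm ((1 / norm x) *\<^sub>R x) = 1 \<and> (\<forall>i\<in>I. cinner (u i) ((1 / norm x) *\<^sub>R x) = 0)"
    using x by (simp add: cinner_scaleR_right)
  then show ?thesis by blast
qed

lemma compact_unit_orthogonal:
  "compact {x. norm x = 1 \<and> (\<forall>i\<in>I. cinner (u i) x = 0)}"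
proof -
  have "closed {x. cinner v x = 0}" for v
    unfolding cinner_def by (intro closed_Collect_eq continuous_intros)
  then have "closed (\<Inter>i\<in>I. {x. cinner (u i) x = 0})"
    by blast
  moreover have "{x. norm x = 1 \<and> (\<forall>i\<in>I. cinner (u i) x = 0)}
      = sphere 0 1 \<inter> (\<Inter>i\<in>I. {x. cinner (u i) x = 0})"
    by auto
  ultimately show ?thesis
    by (simp add: compact_Int_closed)
qed

text \<open>A partial singular value decomposition, indexed by a subset so that it can be built one
  pair of vectors at a time.\<close>

definition singular_system ::
  "complex^'n^'n \<Rightarrow> 'n set \<Rightarrow> ('n \<Rightarrow> complex^'n) \<Rightarrow> ('n \<Rightarrow> complex^'n) \<Rightarrow> ('n \<Rightarrow> real) \<Rightarrow> bool" where
  "singular_system T I u v s \<longleftrightarrow>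
     (\<forall>i\<in>I. \<forall>j\<in>I. cinner (u i) (u j) = (if i = j then 1 else 0)) \<and>
     (\<forall>i\<in>I. \<forall>j\<in>I. cinner (v i) (v j) = (if i = j then 1 else 0)) \<and>
     (\<forall>i\<in>I. 0 \<le> s i \<and> T *v v i = s i *\<^sub>R u i \<and> adjoint_matrix T *v u i = s i *\<^sub>R v i)"

lemma eq_scaleR_if_max_inner:
  fixes u y :: "'a::real_inner"
  assumes "norm u = 1" "norm y \<le> u \<bullet> y"
  shows "y = (u \<bullet> y) *\<^sub>R u"
proof -
  have "u \<bullet> y = norm y"
    using assms norm_cauchy_schwarz[of u y] by simp
  then show ?thesis
    using assms norm_cauchy_schwarz_eq[of u y] by simp
qed

text \<open>A new pair of singular vectors maximises the real part of \<open>\<langle>x, T y\<rangle>\<close> over all pairs of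
  unit vectors orthogonal to the ones already found; the equality case of the Cauchy-Schwarz
  inequality then forces \<open>T y\<close> and \<open>T\<^sup>* x\<close> to be multiples of \<open>x\<close> and \<open>y\<close>.\<close>

lemma singular_system_extend:
  fixes T :: "complex^'n^'n"
  assumes sys: "singular_system T I u v s" and a: "a \<notin> I"
  shows "\<exists>u v s. singular_system T (insert a I) u v s"
proof -
  define K where "K w = {x. norm x = 1 \<and> (\<forall>i\<in>I. cinner (w i) x = 0)}" for w :: "'n \<Rightarrow> complex^'n"
  have "compact (K u \<times> K v)"
    by (simp add: K_def compact_unit_orthogonal compact_Times)
  moreover have "K u \<times> K v \<noteq> {}"
    using exists_unit_orthogonal[OF a] by (auto simp: K_def)
  moreover have "continuous_on (K u \<times> K v) (\<lambda>z. fst z \<bullet> (T *v snd z))"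
    by (intro continuous_intros bounded_linear.continuous_on[OF matrix_vector_mul_bounded_linear])
  ultimately obtain z where z: "z \<in> K u \<times> K v"
      and zmax: "\<And>w. w \<in> K u \<times> K v \<Longrightarrow> fst w \<bullet> (T *v snd w) \<le> fst z \<bullet> (T *v snd z)"
    using continuous_attains_sup[of "K u \<times> K v" "\<lambda>z. fst z \<bullet> (T *v snd z)"] by blast
  obtain x y where xy: "z = (x, y)" by fastforce
  have x: "x \<in> K u" and y: "y \<in> K v"
    and max: "\<And>x' y'. x' \<in> K u \<Longrightarrow> y' \<in> K v \<Longrightarrow> x' \<bullet> (T *v y') \<le> x \<bullet> (T *v y)"
    using z zmax xy by force+
  define \<sigma> where "\<sigma> = x \<bullet> (T *v y)"
  have flip: "x' \<bullet> (T *v y') = y' \<bullet> (adjoint_matrix T *v x')" for x' y'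
    by (metis Re_cinner cinner_adjoint_left inner_commute)
  \<comment> \<open>\<open>T\<close> and its adjoint preserve the orthogonality constraints, since
    they map the singular vectors already found to multiples of each other. Hence
    \<open>T *v y\<close>, once normalised, is an admissible competitor for \<open>x\<close>, and
    likewise \<open>adjoint_matrix T *v x\<close> for \<open>y\<close>.\<close>
  have orthT: "cinner (u i) (T *v y) = 0" if "i \<in> I" for i
  proof -
    have "cinner (u i) (T *v y) = s i *\<^sub>R cinner (v i) y"
      using sys that by (simp add: singular_system_def cinner_scaleR_left flip: cinner_adjoint_left)
    then show ?thesis using y that by (simp add: K_def)
  qed
  have orthT': "cinner (v i) (adjoint_matrix T *v x) = 0" if "i \<in> I" for i
  proof -
    have "cinner (v i) (adjoint_matrix T *v x) = s i *\<^sub>R cinner (u i) x"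
      using sys that by (simp add: singular_system_def cinner_scaleR_left cinner_adjoint_right)
    then show ?thesis using x that by (simp add: K_def)
  qed
  have normalize: "(1 / norm w) *\<^sub>R w \<in> K f"
    if "w \<noteq> 0" "\<And>i. i \<in> I \<Longrightarrow> cinner (f i) w = 0" for f w
    using that by (simp add: K_def cinner_scaleR_right)
  have self: "((1 / norm w) *\<^sub>R w) \<bullet> w = norm w" for w :: "complex^'n"
    by (simp add: dot_square_norm power2_eq_square)
  \<comment> \<open>Replacing \<open>x\<close> by the normalised \<open>T *v y\<close> gives the
    value \<open>norm (T *v y)\<close>, which cannot exceed the maximum.\<close>
  have normT: "norm (T *v y) \<le> \<sigma>"
  proof (cases "T *v y = 0")
    case True
    then show ?thesis by (simp add: \<sigma>_def)
  next
    case False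
    then show ?thesis
      using max[OF normalize[OF False orthT] y] self[of "T *v y"] unfolding \<sigma>_def by metis
  qed
  have normT': "norm (adjoint_matrix T *v x) \<le> \<sigma>"
  proof (cases "adjoint_matrix T *v x = 0")
    case True
    then show ?thesis by (simp add: \<sigma>_def flip)
  next
    case False
    then show ?thesis
      using max[OF x normalize[OF False orthT']] self[of "adjoint_matrix T *v x"]
      unfolding \<sigma>_def flip[of x "(1 / norm w) *\<^sub>R w" for w] by metis
  qed
  have "0 \<le> \<sigma>"
    using normT norm_ge_zero order_trans by blast
  moreover have "T *v y = \<sigma> *\<^sub>R x"
    using eq_scaleR_if_max_inner[of x "T *v y"] normT x by (simp add: \<sigma>_def K_def)
  moreover have "adjoint_matrix T *v x = \<sigma> *\<^sub>R y"
    using eq_scaleR_if_max_inner[of y "adjoint_matrix T *v x"] normT' y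
    by (simp add: \<sigma>_def K_def flip)
  moreover have "cinner x (u i) = 0" "cinner y (v i) = 0" if "i \<in> I" for i
    using x y that cnj_cinner[of "u i" x] cnj_cinner[of "v i" y] by (auto simp: K_def)
  moreover have "cinner x x = 1" "cinner y y = 1"
    using x y by (simp_all add: K_def cinner_self)
  ultimately have "singular_system T (insert a I) (u(a := x)) (v(a := y)) (s(a := \<sigma>))"
    using sys a x y by (auto simp: singular_system_def K_def)
  then show ?thesis by blast
qed

lemma singular_system_exists:
  fixes T :: "complex^'n^'n"
  shows "\<exists>u v s. singular_system T UNIV u v s"
proof -
  have "\<exists>u v s. singular_system T I u v s" if "finite I" for I
    using that
  proof (induction I)
    case empty
    show ?case by (simp add: singular_system_def)
  next
    case (insert a I)
    then show ?case using singular_system_extend by blast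
  qed
  then show ?thesis by simp
qed

section \<open>Diagonal and unitary matrices\<close>

lemma real_diag_mult_right: "(U ** real_diag d) $ i $ j = U $ i $ j * complex_of_real (d j)"
  by (simp add: matrix_matrix_mult_def real_diag_def if_distrib[of "\<lambda>x. _ * x"] cong: if_cong)

lemma real_diag_mult_left: "(real_diag d ** U) $ i $ j = complex_of_real (d i) * U $ i $ j"
  by (simp add: matrix_matrix_mult_def real_diag_def if_distrib[of "\<lambda>x. x * _"] cong: if_cong)

lemma real_diag_mult: "real_diag c ** real_diag d = real_diag (\<lambda>i. c i * d i)"
  by (simp add: vec_eq_iff real_diag_mult_right) (simp add: real_diag_def)

lemma real_diag_vector: "(real_diag d *v x) $ i = d i *\<^sub>R x $ i"
  by (simp add: matrix_vector_mult_def real_diag_def scaleR_conv_of_real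
      if_distrib[of "\<lambda>x. x * _"] cong: if_cong)

lemma real_diag_scaleR: "real_diag (\<lambda>i. c * d i) = c *\<^sub>R real_diag d"
  by (simp add: real_diag_def vec_eq_iff scaleR_conv_of_real[where 'a = complex])

lemma unitary_adjoint_right [simp]: "unitary_matrix U \<Longrightarrow> U ** adjoint_matrix U = mat 1"
  and unitary_adjoint_left [simp]: "unitary_matrix U \<Longrightarrow> adjoint_matrix U ** U = mat 1"
  by (simp_all add: unitary_matrix_def)

lemma unitary_cancel [simp]:
  assumes "unitary_matrix U"
  shows "A ** U ** adjoint_matrix U = A" "A ** adjoint_matrix U ** U = A"
  using assms by (simp_all flip: matrix_mul_assoc)

lemma unitary_adjoint: "unitary_matrix U \<Longrightarrow> unitary_matrix (adjoint_matrix U)"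
  unfolding unitary_matrix_def by simp

lemma unitary_mult:
  assumes "unitary_matrix U" "unitary_matrix V"
  shows "unitary_matrix (U ** V)"
proof -
  have "adjoint_matrix V ** adjoint_matrix U ** (U ** V)
      = adjoint_matrix V ** (adjoint_matrix U ** U) ** V"
    "U ** V ** (adjoint_matrix V ** adjoint_matrix U)
      = U ** (V ** adjoint_matrix V) ** adjoint_matrix U"
    by (simp_all only: matrix_mul_assoc)
  then show ?thesis
    using assms unfolding unitary_matrix_def[of "U ** V"] by (simp add: adjoint_mult)
qed

lemma unitary_norm:
  assumes "unitary_matrix U"
  shows "norm (U *v x) = norm x"
proof -
  have "cinner (U *v x) (U *v x) = cinner (adjoint_matrix U *v (U *v x)) x"
    by (simp add: cinner_adjoint_left)
  then have "cinner (U *v x) (U *v x) = cinner x x"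
    using assms by (simp add: matrix_vector_mul_assoc)
  then have "(norm (U *v x))\<^sup>2 = (norm x)\<^sup>2"
    by (metis Re_cinner power2_norm_eq_inner)
  then show ?thesis by simp
qed

lemma unitary_sum_norm_row:
  assumes "unitary_matrix U"
  shows "(\<Sum>j\<in>UNIV. (cmod (U $ i $ j))\<^sup>2) = 1"
proof -
  have "(U ** adjoint_matrix U) $ i $ i = complex_of_real (\<Sum>j\<in>UNIV. (cmod (U $ i $ j))\<^sup>2)"
    by (simp add: matrix_matrix_mult_def adjoint_matrix_def complex_norm_square del: of_real_power)
  then show ?thesis
    using assms by (simp add: mat_def flip: of_real_sum of_real_power)
qed

lemma unitary_sum_norm_column:
  assumes "unitary_matrix U"
  shows "(\<Sum>i\<in>UNIV. (cmod (U $ i $ j))\<^sup>2) = 1"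
  using unitary_sum_norm_row[OF unitary_adjoint[OF assms], of j]
  by (simp add: adjoint_matrix_def)

section \<open>The decomposition in matrix form, and powers of positive semidefinite
  matrices\<close>

definition is_svd ::
  "complex^'n^'n \<Rightarrow> complex^'n^'n \<Rightarrow> ('n \<Rightarrow> real) \<Rightarrow> complex^'n^'n \<Rightarrow> bool" where
  "is_svd T U s V \<longleftrightarrow> unitary_matrix U \<and> unitary_matrix V \<and> (\<forall>i. 0 \<le> s i) \<and>
     T = U ** real_diag s ** adjoint_matrix V"

lemma unitary_columns:
  assumes "\<And>i j. cinner (u i) (u j) = (if i = j then 1 else 0)"
  shows "unitary_matrix (\<chi> i j. u j $ i)"
proof -
  have "adjoint_matrix (\<chi> i j. u j $ i) ** (\<chi> i j. u j $ i) = mat 1"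
    using assms by (simp add: vec_eq_iff adjoint_matrix_def matrix_matrix_mult_def mat_def cinner_def)
  then show ?thesis
    unfolding unitary_matrix_def by (simp add: matrix_left_right_inverse)
qed

lemma svd_exists:
  fixes T :: "complex^'n^'n"
  shows "\<exists>U s V. is_svd T U s V"
proof -
  obtain u v s where sys: "singular_system T UNIV u v s"
    using singular_system_exists by blast
  define U :: "complex^'n^'n" where "U = (\<chi> i j. u j $ i)"
  define V :: "complex^'n^'n" where "V = (\<chi> i j. v j $ i)"
  have unit: "unitary_matrix U" "unitary_matrix V"
    using sys unfolding U_def V_def by (auto simp: singular_system_def intro!: unitary_columns)
  \<comment> \<open>Column \<open>j\<close> of this identity is the relation between
    \<open>v j\<close> and \<open>u j\<close>; multiplying by the adjoint of \<open>V\<close> then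
    isolates \<open>T\<close>.\<close>
  have "(T ** V) $ i $ j = (U ** real_diag s) $ i $ j" for i j
  proof -
    have "(T ** V) $ i $ j = (T *v v j) $ i"
      by (simp add: V_def matrix_matrix_mult_def matrix_vector_mult_def)
    also have "\<dots> = (U ** real_diag s) $ i $ j"
      using sys by (simp add: singular_system_def real_diag_mult_right U_def
          scaleR_conv_of_real[where 'a = complex])
    finally show ?thesis .
  qed
  then have "T ** V = U ** real_diag s"
    by (simp add: vec_eq_iff)
  then have "T = U ** real_diag s ** adjoint_matrix V"
    using unit unitary_cancel(1)[of V T] by simp
  moreover have "\<forall>i. 0 \<le> s i"
    using sys by (simp add: singular_system_def)
  ultimately have "is_svd T U s V"
    using unit unfolding is_svd_def by blast
  then show ?thesis by blast
qed

text \<open>The unitary \<open>W\<close> intertwines the two diagonal matrices, so a nonzero entry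
  \<open>W $ i $ j\<close> forces \<open>c j = d i\<close> and hence
  \<open>f (c j) = f (d i)\<close>. Thus \<open>W\<close> also intertwines the images under
  \<open>f\<close>. This makes the functional calculus independent of the diagonalisation.\<close>

lemma real_diag_similarity_fun:
  assumes unit: "unitary_matrix U" "unitary_matrix V"
    and eq: "U ** real_diag c ** adjoint_matrix U = V ** real_diag d ** adjoint_matrix V"
  shows "U ** real_diag (\<lambda>i. f (c i)) ** adjoint_matrix U
       = V ** real_diag (\<lambda>i. f (d i)) ** adjoint_matrix V"
proof -
  define W where "W = adjoint_matrix V ** U"
  have "adjoint_matrix V ** (U ** real_diag c ** adjoint_matrix U) ** U
      = adjoint_matrix V ** (V ** real_diag d ** adjoint_matrix V) ** U"
    using eq by simp
  then have "W ** real_diag c = real_diag d ** W"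
    using unit by (simp add: W_def matrix_mul_assoc)
  then have "W $ i $ j * complex_of_real (c j) = complex_of_real (d i) * W $ i $ j" for i j
    by (metis real_diag_mult_right real_diag_mult_left)
  then have "W $ i $ j = 0 \<or> c j = d i" for i j
    by (metis mult.commute mult_cancel_left of_real_eq_iff)
  then have "W $ i $ j * complex_of_real (f (c j)) = complex_of_real (f (d i)) * W $ i $ j" for i j
    by (metis mult.commute mult_zero_left)
  then have "W ** real_diag (\<lambda>i. f (c i)) = real_diag (\<lambda>i. f (d i)) ** W"
    by (simp add: vec_eq_iff real_diag_mult_right real_diag_mult_left)
  then have "V ** (W ** real_diag (\<lambda>i. f (c i))) ** adjoint_matrix U
      = V ** (real_diag (\<lambda>i. f (d i)) ** W) ** adjoint_matrix U"
    by simp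
  then show ?thesis
    using unit by (simp add: W_def matrix_mul_assoc)
qed

lemma psd_power_eq:
  assumes "unitary_matrix U" "\<And>i. 0 \<le> d i"
  shows "psd_power (U ** real_diag d ** adjoint_matrix U) r
       = U ** real_diag (\<lambda>i. d i powr r) ** adjoint_matrix U"
  unfolding psd_power_def
proof (rule the_equality)
  show "\<exists>U' d'. unitary_matrix U' \<and> (\<forall>i. 0 \<le> d' i) \<and>
      U ** real_diag d ** adjoint_matrix U = U' ** real_diag d' ** adjoint_matrix U' \<and>
      U ** real_diag (\<lambda>i. d i powr r) ** adjoint_matrix U
        = U' ** real_diag (\<lambda>i. d' i powr r) ** adjoint_matrix U'"
    using assms by blast
next
  fix S
  assume "\<exists>U' d'. unitary_matrix U' \<and> (\<forall>i. 0 \<le> d' i) \<and>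
      U ** real_diag d ** adjoint_matrix U = U' ** real_diag d' ** adjoint_matrix U' \<and>
      S = U' ** real_diag (\<lambda>i. d' i powr r) ** adjoint_matrix U'"
  then obtain U' d' where "unitary_matrix U'"
    and "U ** real_diag d ** adjoint_matrix U = U' ** real_diag d' ** adjoint_matrix U'"
    and S: "S = U' ** real_diag (\<lambda>i. d' i powr r) ** adjoint_matrix U'"
    by blast
  then show "S = U ** real_diag (\<lambda>i. d i powr r) ** adjoint_matrix U"
    unfolding S
    using real_diag_similarity_fun[OF assms(1), of U' d d' "\<lambda>x. x powr r"] by simp
qed

subsection \<open>Schatten norms\<close>

text \<open>Meant for nonnegative families such as singular values, hence without absolute
  values.\<close>

definition lp_norm :: "ereal \<Rightarrow> ('n::finite \<Rightarrow> real) \<Rightarrow> real" where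
  "lp_norm p s = (if p = \<infinity> then Max (range s)
     else (\<Sum>i\<in>UNIV. s i powr real_of_ereal p) powr (1 / real_of_ereal p))"

text \<open>Unitary factors preserve the Euclidean norm, so only the diagonal factor stretches
  vectors, by at most its largest entry.\<close>

lemma onorm_svd:
  assumes svd: "is_svd T U s V"
  shows "onorm (\<lambda>x. T *v x) = Max (range s)"
proof (rule antisym)
  have T: "T *v x = U *v (real_diag s *v (adjoint_matrix V *v x))" for x
    using svd by (simp add: is_svd_def matrix_vector_mul_assoc matrix_mul_assoc)
  have s: "0 \<le> s i" "s i \<le> Max (range s)" for i
    using svd by (auto simp: is_svd_def)
  have U: "unitary_matrix U" and V: "unitary_matrix V"
    using svd by (auto simp: is_svd_def)
  have diag: "norm (real_diag s *v y) \<le> Max (range s) * norm y" for y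
  proof -
    have "norm (real_diag s *v y) \<le> norm (Max (range s) *\<^sub>R y)"
      unfolding norm_vec_def
    proof (rule L2_set_mono)
      show "norm ((real_diag s *v y) $ i) \<le> norm ((Max (range s) *\<^sub>R y) $ i)" for i
        using s[of i] abs_ge_self[of "Max (range s)"]
        by (auto simp only: real_diag_vector norm_scaleR vector_scaleR_component abs_of_nonneg
            intro!: mult_right_mono norm_ge_zero)
    qed simp
    \<comment> \<open>Comparison with the entry at an arbitrary index shows that the maximum is
      nonnegative, which removes the absolute value around it.\<close>
    then show ?thesis
      using s(1)[of undefined] s(2)[of undefined] by simp
  qed
  show "onorm (\<lambda>x. T *v x) \<le> Max (range s)"
  proof (rule onorm_le)
    show "norm (T *v x) \<le> Max (range s) * norm x" for x
      using diag[of "adjoint_matrix V *v x"] U V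
      by (simp add: T unitary_norm unitary_adjoint)
  qed
  \<comment> \<open>The value \<open>s i\<close> is attained at the \<open>i\<close>-th right
    singular vector, column \<open>i\<close> of \<open>V\<close>.\<close>
  have "s i \<le> onorm (\<lambda>x. T *v x)" for i
  proof -
    have "adjoint_matrix V *v (V *v axis i 1) = axis i 1"
      using V by (simp add: matrix_vector_mul_assoc)
    moreover have "real_diag s *v axis i 1 = s i *\<^sub>R axis i 1"
      by (simp add: vec_eq_iff real_diag_vector axis_def)
    ultimately have "norm (T *v (V *v axis i 1)) = s i"
      using U s(1)[of i] by (simp add: T unitary_norm)
    moreover have "norm (T *v (V *v axis i 1)) \<le> onorm (\<lambda>x. T *v x) * norm (V *v axis i (1::complex))"
      by (rule onorm) simp
    ultimately show ?thesis
      using V by (simp add: unitary_norm)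
  qed
  then show "Max (range s) \<le> onorm (\<lambda>x. T *v x)"
    by auto
qed

text \<open>For finite \<open>p\<close>, the matrix \<open>adjoint_matrix T ** T\<close> is
  diagonalised by \<open>V\<close> with eigenvalues \<open>s i * s i\<close>; the power
  \<open>p/2\<close> turns them into \<open>s i powr p\<close>, and cyclicity of the trace removes
  \<open>V\<close>.\<close>

lemma schatten_norm_svd:
  assumes svd: "is_svd T U s V"
  shows "schatten_norm p T = lp_norm p s"
proof (cases "p = \<infinity>")
  case True
  then show ?thesis
    by (simp add: schatten_norm_def lp_norm_def onorm_svd[OF svd])
next
  case False
  define r where "r = real_of_ereal p"
  have U: "unitary_matrix U" and V: "unitary_matrix V" and s: "\<And>i. 0 \<le> s i"
    and T: "T = U ** real_diag s ** adjoint_matrix V"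
    using svd by (auto simp: is_svd_def)
  have "adjoint_matrix T ** T = V ** (real_diag s ** real_diag s) ** adjoint_matrix V"
    using U by (simp add: T adjoint_mult matrix_mul_assoc)
  then have "adjoint_matrix T ** T = V ** real_diag (\<lambda>i. s i * s i) ** adjoint_matrix V"
    by (simp add: real_diag_mult)
  moreover have "(s i * s i) powr (r / 2) = s i powr r" for i
    using s[of i] by (simp add: powr_mult flip: powr_add)
  ultimately have "psd_power (adjoint_matrix T ** T) (r / 2)
      = V ** real_diag (\<lambda>i. s i powr r) ** adjoint_matrix V"
    by (simp add: psd_power_eq V)
  then have "trace (psd_power (adjoint_matrix T ** T) (r / 2))
      = trace (adjoint_matrix V ** (V ** real_diag (\<lambda>i. s i powr r)))"
    by (simp only: trace_mul_sym[of _ "adjoint_matrix V"])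
  also have "\<dots> = trace (real_diag (\<lambda>i. s i powr r))"
    using V by (simp add: matrix_mul_assoc)
  also have "\<dots> = complex_of_real (\<Sum>i\<in>UNIV. s i powr r)"
    by (simp add: trace_def real_diag_def)
  finally show ?thesis
    using False by (simp add: schatten_norm_def lp_norm_def r_def)
qed

text \<open>Since \<open>|x y| \<le> (|x|\<^sup>2 + |y|\<^sup>2) / 2\<close>, the diagonal entries of \<open>X S Y\<close> are bounded in modulus by
  averages of the \<open>s k\<close> with doubly stochastic weights, and Jensen's inequality applies.\<close>

lemma sum_powr_diagonal_le:
  assumes r: "1 \<le> r" and X: "unitary_matrix X" and Y: "unitary_matrix Y" and s: "\<And>i. 0 \<le> s i"
  shows "(\<Sum>i\<in>UNIV. cmod ((X ** real_diag s ** Y) $ i $ i) powr r) \<le> (\<Sum>k\<in>UNIV. s k powr r)"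
proof -
  define w where "w i k = ((cmod (X $ i $ k))\<^sup>2 + (cmod (Y $ k $ i))\<^sup>2) / 2" for i k
  have w: "0 \<le> w i k" for i k by (simp add: w_def)
  have row: "(\<Sum>k\<in>UNIV. w i k) = 1" for i
    using unitary_sum_norm_row[OF X, of i] unitary_sum_norm_column[OF Y, of i]
    by (simp add: w_def sum.distrib flip: sum_divide_distrib)
  have column: "(\<Sum>i\<in>UNIV. w i k) = 1" for k
    using unitary_sum_norm_row[OF Y, of k] unitary_sum_norm_column[OF X, of k]
    by (simp add: w_def sum.distrib flip: sum_divide_distrib)
  have "cmod ((X ** real_diag s ** Y) $ i $ i) powr r \<le> (\<Sum>k\<in>UNIV. w i k * s k powr r)" for i
  proof -
    have "(X ** real_diag s ** Y) $ i $ i = (\<Sum>k\<in>UNIV. (X ** real_diag s) $ i $ k * Y $ k $ i)"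
      by (simp add: matrix_matrix_mult_def)
    then have "cmod ((X ** real_diag s ** Y) $ i $ i)
        \<le> (\<Sum>k\<in>UNIV. cmod (X $ i $ k) * s k * cmod (Y $ k $ i))"
      using s by (auto simp: real_diag_mult_right norm_mult intro!: order_trans[OF norm_sum] sum_mono)
    also have "\<dots> \<le> (\<Sum>k\<in>UNIV. w i k * s k)"
    proof (rule sum_mono)
      fix k
      have "cmod (X $ i $ k) * cmod (Y $ k $ i) \<le> w i k"
        using sum_squares_bound[of "cmod (X $ i $ k)" "cmod (Y $ k $ i)"] by (simp add: w_def)
      then show "cmod (X $ i $ k) * s k * cmod (Y $ k $ i) \<le> w i k * s k"
        using mult_right_mono[OF _ s[of k]] by (fastforce simp: mult_ac)
    qed
    finally have "cmod ((X ** real_diag s ** Y) $ i $ i) powr r \<le> (\<Sum>k\<in>UNIV. w i k * s k) powr r"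
      using r by (intro powr_mono2) auto
    also have "\<dots> \<le> (\<Sum>k\<in>UNIV. w i k * s k powr r)"
      using convex_on_sum[OF _ _ powr_convex_nonneg[OF r] row, where y = s] w s by simp
    finally show ?thesis .
  qed
  then have "(\<Sum>i\<in>UNIV. cmod ((X ** real_diag s ** Y) $ i $ i) powr r)
      \<le> (\<Sum>i\<in>UNIV. \<Sum>k\<in>UNIV. w i k * s k powr r)"
    by (rule sum_mono)
  also have "\<dots> = (\<Sum>k\<in>UNIV. \<Sum>i\<in>UNIV. w i k * s k powr r)"
    by (rule sum.swap)
  also have "\<dots> = (\<Sum>k\<in>UNIV. s k powr r)"
    by (simp add: column flip: sum_distrib_right)
  finally show ?thesis .
qed

text \<open>\<open>P\<close> and \<open>Q\<close> are absorbed into the unitary factors of a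
  singular value decomposition of \<open>T\<close>.\<close>

lemma sum_powr_diagonal_le_schatten_norm:
  assumes r: "1 \<le> r" and P: "unitary_matrix P" and Q: "unitary_matrix Q"
  shows "(\<Sum>i\<in>UNIV. cmod ((P ** T ** Q) $ i $ i) powr r) \<le> schatten_norm (ereal r) T powr r"
proof -
  obtain U s V where svd: "is_svd T U s V" using svd_exists by blast
  have "(\<Sum>i\<in>UNIV. cmod ((P ** T ** Q) $ i $ i) powr r)
      = (\<Sum>i\<in>UNIV. cmod (((P ** U) ** real_diag s ** (adjoint_matrix V ** Q)) $ i $ i) powr r)"
    using svd by (simp add: is_svd_def matrix_mul_assoc)
  also have "\<dots> \<le> (\<Sum>k\<in>UNIV. s k powr r)"
    using svd P Q r by (intro sum_powr_diagonal_le) (auto simp: is_svd_def intro: unitary_mult unitary_adjoint)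
  also have "\<dots> = schatten_norm (ereal r) T powr r"
    using r by (simp add: schatten_norm_svd[OF svd] lp_norm_def powr_powr sum_nonneg)
  finally show ?thesis .
qed

lemma schatten_norm_nonneg: "0 \<le> schatten_norm p T"
  by (simp add: schatten_norm_def onorm_pos_le)

lemma schatten_norm_triangle:
  fixes A B :: "complex^'n^'n"
  assumes p: "1 \<le> p"
  shows "schatten_norm p (A + B) \<le> schatten_norm p A + schatten_norm p B"
proof (cases p)
  case (real r)
  have r: "1 \<le> r" using p real by simp
  obtain U s V where svd: "is_svd (A + B) U s V" using svd_exists by blast
  have U: "unitary_matrix (adjoint_matrix U)" and V: "unitary_matrix V" and s: "\<And>i. 0 \<le> s i"
    using svd by (auto simp: is_svd_def unitary_adjoint)
  \<comment> \<open>The unitary factors are those of \<open>A + B\<close>, so its singular values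
    are the sums of the corresponding diagonal entries for \<open>A\<close> and
    \<open>B\<close>.\<close>
  define a where "a T i = (adjoint_matrix U ** T ** V) $ i $ i" for T i
  have "real_diag s = adjoint_matrix U ** (A + B) ** V"
    using svd by (simp add: is_svd_def matrix_mul_assoc)
  also have "\<dots> = adjoint_matrix U ** A ** V + adjoint_matrix U ** B ** V"
    by (simp add: matrix_add_ldistrib)
       (simp add: vec_eq_iff matrix_matrix_mult_def distrib_right sum.distrib)
  finally have "real_diag s $ i $ i = a A i + a B i" for i
    by (simp add: a_def)
  then have "complex_of_real (s i) = a A i + a B i" for i
    by (simp add: real_diag_def)
  then have "s i \<le> cmod (a A i) + cmod (a B i)" for i
    using s[of i] norm_triangle_ineq[of "a A i" "a B i"] by (metis abs_of_nonneg norm_of_real)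
  then have "(\<Sum>i\<in>UNIV. s i powr r) \<le> (\<Sum>i\<in>UNIV. (cmod (a A i) + cmod (a B i)) powr r)"
    using s r by (intro sum_mono powr_mono2) auto
  also have "\<dots> \<le> (schatten_norm p A + schatten_norm p B) powr r"
    using sum_powr_diagonal_le_schatten_norm[OF r U V] real
    by (intro Minkowski_powr_sum r) (auto simp: a_def schatten_norm_nonneg)
  finally have "(\<Sum>i\<in>UNIV. s i powr r) powr (1 / r)
      \<le> ((schatten_norm p A + schatten_norm p B) powr r) powr (1 / r)"
    using r by (intro powr_mono2) (auto intro: sum_nonneg)
  then show ?thesis
    using r real by (simp add: schatten_norm_svd[OF svd] lp_norm_def powr_powr schatten_norm_nonneg)
next
  case PInf
  then show ?thesis
    using onorm_triangle[of "(*v) A" "(*v) B"]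
    by (simp add: schatten_norm_def flip: matrix_vector_mult_add_rdistrib)
next
  case MInf
  then show ?thesis using p by simp
qed

lemma mat_mult_left: "(mat c ** T) $ i $ j = c * T $ i $ j"
  by (simp add: matrix_matrix_mult_def mat_def if_distrib[of "\<lambda>x. x * _"] cong: if_cong)

text \<open>The scalar matrix is unitary and is absorbed into the left factor, leaving the singular
  values unchanged.\<close>

lemma schatten_norm_mat_cis:
  fixes T :: "complex^'n^'n"
  shows "schatten_norm p (mat (cis \<theta>) ** T) = schatten_norm p T"
proof -
  obtain U s V where svd: "is_svd T U s V" using svd_exists by blast
  have "adjoint_matrix (mat (cis \<theta>) :: complex^'n^'n) = mat (cis (- \<theta>))"
    by (simp add: adjoint_matrix_def mat_def vec_eq_iff cis_cnj)
  moreover have "mat (cis \<alpha>) ** mat (cis \<beta>) = (mat (cis (\<alpha> + \<beta>)) :: complex^'n^'n)" for \<alpha> \<beta>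
    by (simp add: vec_eq_iff mat_mult_left) (simp add: mat_def cis_mult)
  ultimately have "unitary_matrix (mat (cis \<theta>) :: complex^'n^'n)"
    unfolding unitary_matrix_def by simp
  then have "is_svd (mat (cis \<theta>) ** T) (mat (cis \<theta>) ** U) s V"
    using svd by (simp add: is_svd_def unitary_mult matrix_mul_assoc)
  then show ?thesis
    using schatten_norm_svd svd by metis
qed

subsection \<open>Hermitian dilations\<close>

lemma sum_UNIV_Plus:
  fixes f :: "'a::finite + 'b::finite \<Rightarrow> 'c::comm_monoid_add"
  shows "(\<Sum>i\<in>UNIV. f i) = (\<Sum>a\<in>UNIV. f (Inl a)) + (\<Sum>b\<in>UNIV. f (Inr b))"
  by (simp add: sum.Plus o_def flip: UNIV_Plus_UNIV)

lemma block_matrix_mult: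
  "block_matrix A B C D ** block_matrix A' B' C' D'
     = block_matrix (A ** A' + B ** C') (A ** B' + B ** D') (C ** A' + D ** C') (C ** B' + D ** D')"
  by (auto simp: vec_eq_iff block_matrix_def matrix_matrix_mult_def sum_UNIV_Plus split: sum.split)

lemma adjoint_block_matrix:
  "adjoint_matrix (block_matrix A B C D)
     = block_matrix (adjoint_matrix A) (adjoint_matrix C) (adjoint_matrix B) (adjoint_matrix D)"
  by (auto simp: vec_eq_iff block_matrix_def adjoint_matrix_def split: sum.split)

lemma mat_block_matrix: "mat c = block_matrix (mat c) 0 0 (mat c)"
  by (auto simp: vec_eq_iff block_matrix_def mat_def split: sum.split)

lemma real_diag_block_matrix:
  "real_diag (case_sum c d) = block_matrix (real_diag c) 0 0 (real_diag d)"
  by (auto simp: vec_eq_iff block_matrix_def real_diag_def split: sum.split)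

text \<open>The right factor has its blocks swapped, which moves the two diagonal blocks of the
  product to the off-diagonal positions and keeps all singular values nonnegative.\<close>

lemma is_svd_hermitian_dilation:
  assumes "is_svd C U s V"
  shows "is_svd (block_matrix 0 C (adjoint_matrix C) 0)
     (block_matrix U 0 0 V) (case_sum s s) (block_matrix 0 U V 0)"
  using assms unfolding is_svd_def unitary_matrix_def
  by (auto simp: adjoint_block_matrix block_matrix_mult
      real_diag_block_matrix adjoint_mult matrix_mul_assoc mat_block_matrix[symmetric]
      split: sum.split)

lemma lp_norm_case_sum:
  assumes p: "1 \<le> p" and s: "\<And>i. 0 \<le> s i"
  shows "lp_norm p (case_sum s s) = 2 powr (real_of_ereal (1 / p)) * lp_norm p s"
proof (cases p)
  case (real r)
  then have "1 \<le> r" using p by simp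
  moreover from this have "1 / p = ereal (1 / r)"
    using real by (simp add: one_ereal_def)
  ultimately show ?thesis
    using real s by (simp add: lp_norm_def sum_UNIV_Plus powr_mult sum_nonneg flip: mult_2)
next
  \<comment> \<open>Here \<open>1 / p\<close> is 0, so the factor is 1: repeating the values does
    not change their maximum.\<close>
  case PInf
  have "range (case_sum s s) = range s"
    by (force simp: image_iff split: sum.split)
  then show ?thesis
    using PInf by (simp add: lp_norm_def)
next
  case MInf
  then show ?thesis using p by simp
qed

lemma lp_norm_scale:
  assumes p: "1 \<le> p" and c: "0 \<le> c" and s: "\<And>i. 0 \<le> s i"
  shows "lp_norm p (\<lambda>i. c * s i) = c * lp_norm p s"
proof (cases p)
  case (real r)
  then have "1 \<le> r" using p by simp
  then show ?thesis
    using real s c by (simp add: lp_norm_def powr_mult powr_powr sum_nonneg flip: sum_distrib_left)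
next
  case PInf
  have "mono (\<lambda>x. c * x)"
    using c by (simp add: mono_def mult_left_mono)
  then have "c * Max (range s) = Max ((\<lambda>x. c * x) ` range s)"
    by (intro mono_Max_commute) auto
  then show ?thesis
    using PInf by (simp add: lp_norm_def image_image)
next
  case MInf
  then show ?thesis using p by simp
qed

lemma scaleR_matrix_mult_left: "(c *\<^sub>R A) ** B = c *\<^sub>R (A ** B)"
  for A :: "complex^'n^'m"
  by (simp add: vec_eq_iff matrix_matrix_mult_def scaleR_sum_right)

lemma scaleR_matrix_mult_right: "A ** (c *\<^sub>R B) = c *\<^sub>R (A ** B)"
  for A :: "complex^'n^'m"
  by (simp add: vec_eq_iff matrix_matrix_mult_def scaleR_sum_right)

text \<open>Doubling the singular values contributes the factor \<open>2 powr (1/p)\<close> and the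
  scalar contributes 1/2; the constant in front cancels both.\<close>

lemma schatten_norm_hermitian_dilation_half:
  assumes p: "1 \<le> p"
  shows "2 powr (1 - real_of_ereal (1 / p))
      * schatten_norm p ((1 / 2) *\<^sub>R block_matrix 0 C (adjoint_matrix C) 0) = schatten_norm p C"
proof -
  obtain U s V where svd: "is_svd C U s V" using svd_exists by blast
  have s: "0 \<le> s i" for i using svd by (simp add: is_svd_def)
  define t where "t = case_sum s s"
  have t: "0 \<le> t i" for i using s by (simp add: t_def split: sum.split)
  have "is_svd ((1 / 2) *\<^sub>R block_matrix 0 C (adjoint_matrix C) 0)
      (block_matrix U 0 0 V) (\<lambda>i. 1 / 2 * t i) (block_matrix 0 U V 0)"
    using is_svd_hermitian_dilation[OF svd]
    unfolding is_svd_def real_diag_scaleR t_def[symmetric]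
    by (simp add: scaleR_matrix_mult_left scaleR_matrix_mult_right)
  then have "schatten_norm p ((1 / 2) *\<^sub>R block_matrix 0 C (adjoint_matrix C) 0)
      = 1 / 2 * (2 powr (real_of_ereal (1 / p)) * lp_norm p s)"
    using lp_norm_scale[OF p, of "1 / 2" t] t lp_norm_case_sum[OF p s]
    by (simp add: schatten_norm_svd t_def)
  then show ?thesis
    using svd by (simp add: schatten_norm_svd powr_diff field_simps)
qed

text \<open>The adjoint moves the lower left block to the upper right and conjugates the phase,
  which is why \<open>B\<close> appears with \<open>cis (- \<theta>)\<close>.\<close>

lemma re_part_off_diagonal:
  "re_part (mat (cis \<theta>) ** block_matrix 0 A (adjoint_matrix B) 0)
     = (1 / 2) *\<^sub>R block_matrix 0 (mat (cis \<theta>) ** A + mat (cis (- \<theta>)) ** B)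
         (adjoint_matrix (mat (cis \<theta>) ** A + mat (cis (- \<theta>)) ** B)) 0"
  by (auto simp: re_part_def vec_eq_iff block_matrix_def adjoint_matrix_def mat_mult_left cis_cnj
      split: sum.split)

theorem theorem4p1:
  fixes A B :: "complex^'n^'n" and p :: ereal
  assumes "1 \<le> p"
  shows "schatten_norm p (A + B)
           \<le> 2 powr (1 - real_of_ereal (1 / p))
               * schatten_num_radius p (block_matrix 0 A (adjoint_matrix B) 0)
       \<and> 2 powr (1 - real_of_ereal (1 / p))
               * schatten_num_radius p (block_matrix 0 A (adjoint_matrix B) 0)
           \<le> schatten_norm p A + schatten_norm p B"
proof -
  define c :: real where "c = 2 powr (1 - real_of_ereal (1 / p))"
  define g where "g \<theta> = schatten_norm p
    (re_part (mat (cis \<theta>) ** block_matrix 0 A (adjoint_matrix B) 0))" for \<theta>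
  have c: "0 < c" by (simp add: c_def)
  have cg: "c * g \<theta> = schatten_norm p (mat (cis \<theta>) ** A + mat (cis (- \<theta>)) ** B)" for \<theta>
    by (simp only: c_def g_def re_part_off_diagonal schatten_norm_hermitian_dilation_half[OF assms])
  have "c * g \<theta> \<le> schatten_norm p A + schatten_norm p B" for \<theta>
    using schatten_norm_triangle[OF assms, of "mat (cis \<theta>) ** A" "mat (cis (- \<theta>)) ** B"]
    by (simp only: cg schatten_norm_mat_cis)
  \<comment> \<open>A bound uniform in \<theta>: it makes the real supremum an actual upper bound of
    the values \<open>g \<theta>\<close>, and it also yields the second inequality.\<close>
  then have bound: "g \<theta> \<le> (schatten_norm p A + schatten_norm p B) / c" for \<theta>
    using c by (simp add: pos_le_divide_eq mult.commute)
  then have "g 0 \<le> (SUP \<theta>. g \<theta>)"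
    by (intro cSUP_upper) (auto intro!: bdd_aboveI)
  then have "c * g 0 \<le> c * (SUP \<theta>. g \<theta>)"
    using c by simp
  \<comment> \<open>At \<theta> = 0 both phases are 1, so \<open>c * g 0\<close> is the norm of
    \<open>A + B\<close>.\<close>
  then have "schatten_norm p (A + B) \<le> c * (SUP \<theta>. g \<theta>)"
    unfolding cg by simp
  moreover have "(SUP \<theta>. g \<theta>) \<le> (schatten_norm p A + schatten_norm p B) / c"
    using bound by (intro cSUP_least) auto
  then have "c * (SUP \<theta>. g \<theta>) \<le> schatten_norm p A + schatten_norm p B"
    using c by (simp add: pos_le_divide_eq mult.commute)
  ultimately show ?thesis
    by (simp add: c_def g_def schatten_num_radius_def)
qed

end
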